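(* Let $\mathcal{H},\mathcal{F}\in\mathfrak{C}^1([-1,1])$, let $r_0>0$, and consider the $\mathcal{H}$-catenoid $\Sigma_{\mathcal{H}}(r_0)$. Then: \begin{itemize} \item[1.] If $\mathcal{H}\sim_1\mathcal{F}$, then the upper end of each $\mathcal{F}$-catenoid $\Sigma_{\mathcal{F}}(r)$, $r>0$, has the same behavior at infinity as the upper end of $\Sigma_{\mathcal{H}}(r_0)$. \item[2.] If $\mathcal{H}\sim_{-1}\mathcal{F}$, then the lower end of each $\mathcal{F}$-catenoid $\Sigma_{\mathcal{F}}(r)$, $r>0$, has the same behavior at infinity as the lower end of $\Sigma_{\mathcal{H}}(r_0)$. \item[3.] If $\mathcal{H}\sim\mathcal{F}$, then both ends of each $\mathcal{F}$-catenoid $\Sigma_{\mathcal{F}}(r)$, $r>0$, have the same behavior at infinity as the corresponding ends of $\Sigma_{\mathcal{H}}(r_0)$. \end{itemize}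
   Context: $\mathfrak{C}^1([-1,1]):=\{\mathcal{H}\in C^1([-1,1]):\ \mathcal{H}(y)<0\ \text{for all } y\in(-1,1),\ \mathcal{H}(-1)=\mathcal{H}(1)=0\}$. For $\mathcal{H}\in\mathfrak{C}^1([-1,1])$, an $\mathcal{H}$-surface is an immersed oriented surface $\Sigma\subset\mathbb{R}^3$ with unit normal $\eta$ whose mean curvature (half the sum of principal curvatures) is $H_\Sigma=\mathcal{H}(\langle\eta,e_3\rangle)$, $e_3=(0,0,1)$. For every $r_0>0$ the $\mathcal{H}$-catenoid $\Sigma_{\mathcal{H}}(r_0)$ is the (known to exist and unique) properly embedded annular $\mathcal{H}$-surface, rotationally symmetric about the $z$-axis, which is a bi-graph over the exterior of the disk $D(0,r_0)$ in $\{z=0\}$, meeting $\{z=0\}$ orthogonally along its waist, the circle of radius $r_0$ (its necksize); its unit normal points inwards at the waist, upwards on the upper end $\Sigma_{\mathcal{H}}^+(r_0)=\Sigma_{\mathcal{H}}(r_0)\cap\{z\ge0\}$ and downwards on the lower end $\Sigma_{\mathcal{H}}^-(r_0)=\Sigma_{\mathcal{H}}(r_0)\cap\{z\le0\}$. The upper and lower ends are obtained by rotating about the $z$-axis the graphs $z=f_+(x)$ and $z=f_-(x)$, $x>r_0$, where $f_+$ (upper height) and $f_-$ (lower height) satisfy $$2\mathcal{H}\Big(\tfrac{1}{\sqrt{1+f_+'^2}}\Big)=\frac{f_+''}{(1+f_+'^2)^{3/2}}+\frac{f_+'}{x\sqrt{1+f_+'^2}},\qquad -2\mathcal{H}\Big(\tfrac{-1}{\sqrt{1+f_-'^2}}\Big)=\frac{f_-''}{(1+f_-'^2)^{3/2}}+\frac{f_-'}{x\sqrt{1+f_-'^2}},$$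 with $f_\pm(x)\to0$ and $f_\pm'(x)\to\pm\infty$ as $x\to r_0^+$. The behavior at infinity of the upper (resp. lower) end of a catenoid is the boundedness or unboundedness of its upper height $f_+$ (resp. lower height $f_-$) on $(r_0,\infty)$; two ends have the same behavior at infinity if both height functions are bounded or both are unbounded. For $\mathcal{H},\mathcal{F}\in\mathfrak{C}^1([-1,1])$: $\mathcal{H}\sim_1\mathcal{F}$ means $\lim_{y\to1}\mathcal{H}(y)/\mathcal{F}(y)=C_1$ for some nonzero constant $C_1$; $\mathcal{H}\sim_{-1}\mathcal{F}$ means $\lim_{y\to-1}\mathcal{H}(y)/\mathcal{F}(y)=C_2$ for some nonzero constant $C_2$; $\mathcal{H}\sim\mathcal{F}$ means both. *)

theory Defs
  imports "HOL-Analysis.Analysis"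
begin

section \<open>The function class and the asymptotic relations\<close>

text \<open>Only the values on \<open>[-1,1]\<close> matter; the derivative is one-sided at the endpoints.\<close>

definition C1_class :: "(real \<Rightarrow> real) set" where
  "C1_class = {H.
     (\<exists>H'. (\<forall>y\<in>{-1..1}. (H has_real_derivative H' y) (at y within {-1..1})) \<and>
           continuous_on {-1..1} H') \<and>
     (\<forall>y\<in>{-1<..<1}. H y < 0) \<and> H (-1) = 0 \<and> H 1 = 0}"

definition sim_1 :: "(real \<Rightarrow> real) \<Rightarrow> (real \<Rightarrow> real) \<Rightarrow> bool" where
  "sim_1 H F \<longleftrightarrow> (\<exists>C. C \<noteq> 0 \<and> ((\<lambda>y. H y / F y) \<longlongrightarrow> C) (at_left 1))"

definition sim_minus_1 :: "(real \<Rightarrow> real) \<Rightarrow> (real \<Rightarrow> real) \<Rightarrow> bool" where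
  "sim_minus_1 H F \<longleftrightarrow> (\<exists>C. C \<noteq> 0 \<and> ((\<lambda>y. H y / F y) \<longlongrightarrow> C) (at_right (-1)))"

definition sim :: "(real \<Rightarrow> real) \<Rightarrow> (real \<Rightarrow> real) \<Rightarrow> bool" where
  "sim H F \<longleftrightarrow> sim_1 H F \<and> sim_minus_1 H F"

section \<open>Oriented embedded surfaces in space and their mean curvature\<close>

definition C2_on :: "(real \<times> real) set \<Rightarrow> (real \<times> real \<Rightarrow> real^3) \<Rightarrow> bool" where
  "C2_on V X \<longleftrightarrow>
     (\<exists>(D :: real \<times> real \<Rightarrow> (real \<times> real) \<Rightarrow>\<^sub>L (real^3))
       (D2 :: real \<times> real \<Rightarrow> (real \<times> real) \<Rightarrow>\<^sub>L ((real \<times> real) \<Rightarrow>\<^sub>L (real^3))).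
        (\<forall>q\<in>V. (X has_derivative blinfun_apply (D q)) (at q)) \<and>
        (\<forall>q\<in>V. (D has_derivative blinfun_apply (D2 q)) (at q)) \<and>
        continuous_on V D2)"

definition local_chart :: "(real^3) set \<Rightarrow> (real \<times> real) set \<Rightarrow> (real \<times> real \<Rightarrow> real^3) \<Rightarrow> bool" where
  "local_chart S V X \<longleftrightarrow>
     open V \<and> C2_on V X \<and>
     (\<forall>q\<in>V. inj (frechet_derivative X (at q))) \<and>
     openin (top_of_set S) (X ` V) \<and>
     (\<exists>Y. homeomorphism V (X ` V) X Y)"

definition regular_surface :: "(real^3) set \<Rightarrow> bool" where
  "regular_surface S \<longleftrightarrow> (\<forall>p\<in>S. \<exists>V X. local_chart S V X \<and> p \<in> X ` V)"

definition tangent_plane :: "(real^3) set \<Rightarrow> real^3 \<Rightarrow> (real^3) set" where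
  "tangent_plane S p =
     {v. \<exists>V X q w. local_chart S V X \<and> q \<in> V \<and> X q = p \<and> v = frechet_derivative X (at q) w}"

definition unit_normal :: "(real^3) set \<Rightarrow> (real^3 \<Rightarrow> real^3) \<Rightarrow> bool" where
  "unit_normal S \<eta> \<longleftrightarrow>
     continuous_on S \<eta> \<and>
     (\<forall>p\<in>S. norm (\<eta> p) = 1 \<and> (\<forall>v\<in>tangent_plane S p. \<eta> p \<bullet> v = 0))"

text \<open>
  The principal curvatures are the eigenvalues, with multiplicity, of the shape operator
  \<open>- d\<eta>\<close> on the tangent plane: there is an orthonormal basis of the tangent plane consisting of
  eigenvectors. The vectors \<open>w1\<close>, \<open>w2\<close> are the coordinates of this basis in a chart \<open>X\<close>, and
  \<open>d\<eta>\<close> is computed as the derivative of \<open>\<eta> \<circ> X\<close>. With this sign a round sphere has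
  positive curvatures with respect to its inner normal.
\<close>

definition principal_curvatures ::
    "(real^3) set \<Rightarrow> (real^3 \<Rightarrow> real^3) \<Rightarrow> real^3 \<Rightarrow> real \<Rightarrow> real \<Rightarrow> bool" where
  "principal_curvatures S \<eta> p k1 k2 \<longleftrightarrow>
     (\<exists>V X q w1 w2. local_chart S V X \<and> q \<in> V \<and> X q = p \<and>
        (\<eta> \<circ> X) differentiable (at q) \<and>
        (let dX = frechet_derivative X (at q);
             dN = frechet_derivative (\<eta> \<circ> X) (at q)
         in norm (dX w1) = 1 \<and> norm (dX w2) = 1 \<and> dX w1 \<bullet> dX w2 = 0 \<and>
            - dN w1 = k1 *\<^sub>R dX w1 \<and> - dN w2 = k2 *\<^sub>R dX w2))"

definition has_mean_curvature ::
    "(real^3) set \<Rightarrow> (real^3 \<Rightarrow> real^3) \<Rightarrow> real^3 \<Rightarrow> real \<Rightarrow> bool" where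
  "has_mean_curvature S \<eta> p h \<longleftrightarrow>
     (\<exists>k1 k2. principal_curvatures S \<eta> p k1 k2 \<and> h = (k1 + k2) / 2)"

definition H_surface :: "(real \<Rightarrow> real) \<Rightarrow> (real^3) set \<Rightarrow> (real^3 \<Rightarrow> real^3) \<Rightarrow> bool" where
  "H_surface H S \<eta> \<longleftrightarrow>
     regular_surface S \<and> unit_normal S \<eta> \<and>
     (\<forall>p\<in>S. has_mean_curvature S \<eta> p (H (\<eta> p \<bullet> axis 3 1)))"

section \<open>Catenoids\<close>

definition rotation_z :: "real \<Rightarrow> real^3 \<Rightarrow> real^3" where
  "rotation_z t p = vector [cos t * p$1 - sin t * p$2, sin t * p$1 + cos t * p$2, p$3]"

definition axis_dist :: "real^3 \<Rightarrow> real" where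
  "axis_dist p = sqrt ((p$1)\<^sup>2 + (p$2)\<^sup>2)"

definition rotated_graph :: "real \<Rightarrow> (real \<Rightarrow> real) \<Rightarrow> (real^3) set" where
  "rotated_graph r f = {p. r \<le> axis_dist p \<and> p$3 = f (axis_dist p)}"

definition upper_end :: "(real^3) set \<Rightarrow> (real^3) set" where
  "upper_end S = {p\<in>S. 0 \<le> p$3}"

definition lower_end :: "(real^3) set \<Rightarrow> (real^3) set" where
  "lower_end S = {p\<in>S. p$3 \<le> 0}"

definition bigraph :: "real \<Rightarrow> (real^3) set \<Rightarrow> bool" where
  "bigraph r S \<longleftrightarrow>
     (\<exists>f g. continuous_on {r..} f \<and> continuous_on {r..} g \<and>
            upper_end S = rotated_graph r f \<and> lower_end S = rotated_graph r g)"

text \<open>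
  A surface embedded in space is properly embedded iff it is a closed set. The condition on the
  normal along the waist says both that the surface meets the plane \<open>z = 0\<close> orthogonally and
  that the normal points inwards there.
\<close>

definition catenoid :: "(real \<Rightarrow> real) \<Rightarrow> real \<Rightarrow> (real^3) set \<Rightarrow> bool" where
  "catenoid H r S \<longleftrightarrow>
     (\<exists>\<eta>. H_surface H S \<eta> \<and>
        closed S \<and>
        S homeomorphic (sphere (0 :: real^2) 1 \<times> (UNIV :: real set)) \<and>
        (\<forall>t. rotation_z t ` S = S) \<and>
        bigraph r S \<and>
        {p\<in>S. p$3 = 0} = {p. p$3 = 0 \<and> axis_dist p = r} \<and>
        (\<forall>p\<in>S. p$3 = 0 \<longrightarrow> \<eta> p = - (1 / r) *\<^sub>R p) \<and>
        (\<forall>p\<in>S. p$3 > 0 \<longrightarrow> \<eta> p \<bullet> axis 3 1 > 0) \<and>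
        (\<forall>p\<in>S. p$3 < 0 \<longrightarrow> \<eta> p \<bullet> axis 3 1 < 0))"

text \<open>The height functions whose graphs over \<open>x \<ge> r\<close> generate the two ends of a catenoid
  of necksize \<open>r\<close>; they are not meaningful for \<open>x < r\<close>.\<close>

definition upper_height :: "(real^3) set \<Rightarrow> real \<Rightarrow> real" where
  "upper_height S x = (THE z. vector [x, 0, z] \<in> upper_end S)"

definition lower_height :: "(real^3) set \<Rightarrow> real \<Rightarrow> real" where
  "lower_height S x = (THE z. vector [x, 0, z] \<in> lower_end S)"

definition same_upper_behavior :: "real \<Rightarrow> (real^3) set \<Rightarrow> real \<Rightarrow> (real^3) set \<Rightarrow> bool" where
  "same_upper_behavior r S r' S' \<longleftrightarrow>
     (bounded (upper_height S ` {r<..}) \<longleftrightarrow> bounded (upper_height S' ` {r'<..}))"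

definition same_lower_behavior :: "real \<Rightarrow> (real^3) set \<Rightarrow> real \<Rightarrow> (real^3) set \<Rightarrow> bool" where
  "same_lower_behavior r S r' S' \<longleftrightarrow>
     (bounded (lower_height S ` {r<..}) \<longleftrightarrow> bounded (lower_height S' ` {r'<..}))"

end

theory Submission
  imports Defs
begin

text \<open>
  Describe one end by its slope: let \<open>u = f' / sqrt (1 + f'\<^sup>2)\<close> be the sine of the angle of
  inclination of the profile curve, so that the vertical component of the normal is
  \<open>sqrt (1 - u\<^sup>2)\<close> up to sign. The mean curvature equation is of first order in \<open>u\<close>:
  with \<open>P y = H y\<close> for the upper and \<open>P y = H (- y)\<close> for the lower end it reads
  \<open>u' + u / x = 2 * P (sqrt (1 - u\<^sup>2))\<close>, with \<open>u = 1\<close> on the waist. It is read off from the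
  geometric definition in \<open>profile_equation\<close>. The upper and the lower end are treated at once by
  means of a sign \<open>\<sigma>\<close>, and a chart enters only through its derivative at one point: over the plane,
  the projected chart has an invertible derivative and a continuous inverse, which is therefore
  differentiable, and the form of the graph gives the normal explicitly in terms of \<open>u\<close>.

  Since \<open>P\<close> vanishes at 1 at least linearly, \<open>u = 0\<close> cannot be reached in finite time; hence
  \<open>u\<close> stays positive, \<open>x * u x\<close> decreases, and \<open>u\<close> decreases from 1 to 0. So \<open>u\<close> itself can serve
  as the parameter of an end, and two ends for different functions and different necksizes can be
  compared at points \<open>x\<close> and \<open>\<phi> x\<close> of equal slope \<open>t\<close>. With \<open>h = - P (sqrt (1 - t\<^sup>2))\<close> and the
  analogous \<open>k\<close> for the other end,
  \<open>\<phi>' = (t / x + 2 * h) / (t / \<phi> + 2 * k)\<close>.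
  If \<open>h \<ge> a * k\<close> for small slopes then \<open>\<phi> x / x\<close> is nondecreasing wherever it is below \<open>a\<close>, hence it stays
  above a constant \<open>1 / K\<close>, and then the formula gives \<open>\<phi>' \<ge> 1 / K\<close>. As the two profiles
  have equal derivatives at corresponding points, the height over \<open>x\<close> grows at most \<open>K\<close> times as fast as
  the height over \<open>\<phi> x\<close>, so boundedness passes from the second end to the first
  (\<open>bounded_height_comparison\<close>). A nonzero limit of the quotient of the two functions gives the
  inequality in both directions.
\<close>

section \<open>Crossing a level\<close>

lemma first_crossing:
  fixes q :: "real \<Rightarrow> real"
  assumes "a \<le> b" "continuous_on {a..b} q" "c < q a" "q b \<le> c"
  obtains x where "a < x" "x \<le> b" "q x = c" "\<And>y. a \<le> y \<Longrightarrow> y < x \<Longrightarrow> c < q y"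
proof -
  define Z where "Z = {x \<in> {a..b}. q x = c}"
  have "\<exists>x\<ge>a. x \<le> b \<and> q x = c"
    using assms by (intro IVT2') auto
  then have "Z \<noteq> {}" by (auto simp: Z_def)
  moreover have "closed Z"
    unfolding Z_def using assms by (intro continuous_closed_preimage_constant) auto
  moreover have bdd: "bdd_below Z" by (auto simp: Z_def intro!: bdd_belowI[of _ a])
  ultimately have "Inf Z \<in> Z" by (intro closed_contains_Inf)
  then have *: "a \<le> Inf Z" "Inf Z \<le> b" "q (Inf Z) = c" by (auto simp: Z_def)
  show thesis
  proof (rule that[of "Inf Z"])
    show "a < Inf Z" using * assms by (cases "a = Inf Z") auto
    fix y assume y: "a \<le> y" "y < Inf Z"
    show "c < q y"
    proof (rule ccontr)
      assume "\<not> c < q y"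
      then have "\<exists>x\<ge>a. x \<le> y \<and> q x = c"
        using assms y * by (intro IVT2') (auto intro: continuous_on_subset)
      then obtain x where "x \<in> Z" "x \<le> y" using y * by (auto simp: Z_def)
      with cInf_lower[OF _ bdd] y show False by fastforce
    qed
  qed (use * in auto)
qed

lemma last_crossing:
  fixes q :: "real \<Rightarrow> real"
  assumes "a \<le> b" "continuous_on {a..b} q" "c \<le> q a" "q b < c"
  obtains x where "a \<le> x" "x < b" "q x = c" "\<And>y. x < y \<Longrightarrow> y \<le> b \<Longrightarrow> q y < c"
proof -
  have "continuous_on {-b..-a} (\<lambda>x. - q (- x))"
    using assms by (intro continuous_intros continuous_on_compose2[OF assms(2)]) auto
  then obtain x where x: "-b < x" "x \<le> -a" "- q (- x) = - c" "\<And>y. -b \<le> y \<Longrightarrow> y < x \<Longrightarrow> - c < - q (- y)"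
    using first_crossing[of "-b" "-a" "\<lambda>x. - q (- x)" "-c"] assms by auto
  show thesis
  proof (rule that[of "-x"])
    show "q y < c" if "-x < y" "y \<le> b" for y
      using x(4)[of "-y"] that by auto
  qed (use x in auto)
qed

text \<open>
  A function that is nondecreasing wherever it lies below a level cannot fall below this level: look
  at it after the last time it was on the level.
\<close>

lemma barrier:
  fixes q q' :: "real \<Rightarrow> real"
  assumes "a \<le> b" "continuous_on {a..b} q" "c \<le> q a"
    and D: "\<And>x. a < x \<Longrightarrow> x < b \<Longrightarrow> (q has_real_derivative q' x) (at x)"
    and N: "\<And>x. a < x \<Longrightarrow> x < b \<Longrightarrow> q x < c \<Longrightarrow> 0 \<le> q' x"
  shows "c \<le> q b"
proof (rule ccontr)
  assume "\<not> c \<le> q b"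
  then have "q b < c" by simp
  from last_crossing[OF assms(1-3) this] obtain x where
    x: "a \<le> x" "x < b" "q x = c" "\<And>y. x < y \<Longrightarrow> y \<le> b \<Longrightarrow> q y < c" by blast
  have "q x \<le> q b"
  proof (rule DERIV_nonneg_imp_increasing_open[of x b q])
    show "continuous_on {x..b} q" using assms x by (auto intro: continuous_on_subset)
    show "\<exists>d. (q has_real_derivative d) (at y) \<and> 0 \<le> d" if "x < y" "y < b" for y
      using D[of y] N[of y] x(1,4) that by force
  qed (use x in auto)
  with x \<open>q b < c\<close> show False by simp
qed

section \<open>The differential equation of an end\<close>

text \<open>
  The profile of an end of necksize \<open>r\<close>, in terms of the sine \<open>u\<close> of its angle of inclination and
  its height \<open>g\<close>. The waist condition \<open>u r = 1\<close> is a vertical tangent.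
\<close>

definition end_profile :: "(real \<Rightarrow> real) \<Rightarrow> real \<Rightarrow> (real \<Rightarrow> real) \<Rightarrow> (real \<Rightarrow> real) \<Rightarrow> bool" where
  "end_profile P r u g \<longleftrightarrow>
     0 < r \<and> continuous_on {r..} u \<and> continuous_on {r..} g \<and> u r = 1 \<and>
     (\<forall>x>r. \<bar>u x\<bar> < 1 \<and>
            (u has_real_derivative 2 * P (sqrt (1 - (u x)\<^sup>2)) - u x / x) (at x) \<and>
            (g has_real_derivative u x / sqrt (1 - (u x)\<^sup>2)) (at x))"

text \<open>
  The half of the function class that governs one end. The Lipschitz bound at 1, where the normal is
  vertical, stands for continuous differentiability.
\<close>

definition end_curvature :: "(real \<Rightarrow> real) \<Rightarrow> bool" where
  "end_curvature P \<longleftrightarrow> (\<forall>y\<in>{0<..<1}. P y < 0) \<and> P 1 = 0 \<and> (\<exists>L\<ge>0. \<forall>y\<in>{0..1}. \<bar>P y\<bar> \<le> L * (1 - y))"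

lemma one_minus_sqrt_le:
  fixes t :: real assumes "0 \<le> t" "t \<le> 1" shows "1 - sqrt (1 - t\<^sup>2) \<le> t\<^sup>2"
proof -
  have "t\<^sup>2 \<le> 1" using assms by (simp add: power_le_one)
  then have "(1 - t\<^sup>2)\<^sup>2 \<le> 1 - t\<^sup>2" by (auto simp: power2_eq_square intro!: mult_left_le)
  then have "1 - t\<^sup>2 \<le> sqrt (1 - t\<^sup>2)" by (rule real_le_rsqrt)
  then show ?thesis by simp
qed

text \<open>
  The normal never becomes vertical. Up to the first zero of \<open>u\<close>, the Lipschitz bound and
  \<open>1 - sqrt (1 - u\<^sup>2) \<le> u\<^sup>2 \<le> u\<close> turn the equation into \<open>(x * u)' \<ge> - 2 * L * (x * u)\<close>,
  so that \<open>exp (2 * L * x) * (x * u)\<close> does not decrease and there is no first zero.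
\<close>

lemma end_profile_pos:
  assumes E: "end_profile P r u g" and P: "end_curvature P" and x: "r \<le> x"
  shows "0 < u x"
proof (rule ccontr)
  assume "\<not> 0 < u x"
  obtain L where L: "0 \<le> L" "\<And>y. y \<in> {0..1} \<Longrightarrow> \<bar>P y\<bar> \<le> L * (1 - y)"
    using P unfolding end_curvature_def by blast
  have r: "0 < r" and cu: "continuous_on {r..} u" and ur: "u r = 1"
    and bu: "\<And>x. r < x \<Longrightarrow> \<bar>u x\<bar> < 1"
    and du: "\<And>x. r < x \<Longrightarrow> (u has_real_derivative 2 * P (sqrt (1 - (u x)\<^sup>2)) - u x / x) (at x)"
    using E unfolding end_profile_def by auto
  obtain b where b: "r < b" "b \<le> x" "u b = 0" "\<And>y. r \<le> y \<Longrightarrow> y < b \<Longrightarrow> 0 < u y"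
  proof (rule first_crossing[of r x u 0])
    show "continuous_on {r..x} u" using cu by (rule continuous_on_subset) auto
  qed (use x ur \<open>\<not> 0 < u x\<close> in auto)
  define q where "q y = exp (2 * L * y) * (y * u y)" for y
  have "q r \<le> q b"
  proof (rule DERIV_nonneg_imp_increasing_open[of r b q])
    show "continuous_on {r..b} q"
      unfolding q_def using cu by (intro continuous_intros) (auto intro: continuous_on_subset)
    fix y assume y: "r < y" "y < b"
    let ?p = "P (sqrt (1 - (u y)\<^sup>2))"
    have uy: "0 < u y" "u y < 1" using b(4)[of y] bu[of y] y by auto
    have "(q has_real_derivative exp (2 * L * y) * (2 * L * (y * u y) + 2 * y * ?p)) (at y)"
      unfolding q_def using y r
      by (auto intro!: derivative_eq_intros du simp: field_simps)
    moreover have "0 \<le> exp (2 * L * y) * (2 * L * (y * u y) + 2 * y * ?p)"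
    proof -
      have "\<bar>?p\<bar> \<le> L * (1 - sqrt (1 - (u y)\<^sup>2))"
        by (rule L(2)) (use uy in \<open>auto simp: power_le_one\<close>)
      also have "\<dots> \<le> L * (u y)\<^sup>2" using one_minus_sqrt_le[of "u y"] uy L by (intro mult_left_mono) auto
      also have "\<dots> \<le> L * u y" using uy L by (intro mult_left_mono) (auto simp: power2_eq_square)
      finally have "0 \<le> L * u y + ?p" by linarith
      then have "0 \<le> 2 * y * (L * u y + ?p)" using y r by (intro mult_nonneg_nonneg) auto
      then have "0 \<le> 2 * L * (y * u y) + 2 * y * ?p" by (simp add: algebra_simps)
      then show ?thesis by simp
    qed
    ultimately show "\<exists>d. (q has_real_derivative d) (at y) \<and> 0 \<le> d" by blast
  qed (use b in auto)
  moreover have "0 < q r" using r ur by (simp add: q_def)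
  ultimately show False using b by (simp add: q_def)
qed

lemma end_profile_below_one:
  assumes "end_profile P r u g" "end_curvature P" "r < x"
  shows "0 < u x" "u x < 1" "P (sqrt (1 - (u x)\<^sup>2)) < 0"
proof -
  show 1: "0 < u x" using end_profile_pos assms by simp
  show 2: "u x < 1" using assms unfolding end_profile_def by force
  have "0 < 1 - (u x)\<^sup>2" "1 - (u x)\<^sup>2 < 1"
    using 1 2 by (auto simp: power_less_one_iff abs_square_less_1)
  then show "P (sqrt (1 - (u x)\<^sup>2)) < 0"
    using assms(2) by (auto simp: end_curvature_def)
qed

lemma end_profile_decreasing:
  assumes E: "end_profile P r u g" and P: "end_curvature P" and "r \<le> x" "x < y"
  shows "u y < u x"
proof (rule DERIV_neg_imp_decreasing_open[OF \<open>x < y\<close>])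
  show "continuous_on {x..y} u" using E assms unfolding end_profile_def by (auto intro: continuous_on_subset)
  fix z assume z: "x < z" "z < y"
  have "(u has_real_derivative 2 * P (sqrt (1 - (u z)\<^sup>2)) - u z / z) (at z)"
    using E assms z unfolding end_profile_def by auto
  moreover have "0 < u z / z" "P (sqrt (1 - (u z)\<^sup>2)) < 0"
    using end_profile_below_one[OF E P, of z] z assms E unfolding end_profile_def by auto
  ultimately show "\<exists>d. (u has_real_derivative d) (at z) \<and> d < 0"
    by (intro exI[of _ "2 * P (sqrt (1 - (u z)\<^sup>2)) - u z / z"]) auto
qed

text \<open>
  The equation says \<open>(x * u)' = 2 * x * P (sqrt (1 - u\<^sup>2))\<close>, which is negative, and \<open>x * u\<close>
  starts at \<open>r\<close>.
\<close>

lemma end_profile_decay: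
  assumes E: "end_profile P r u g" and P: "end_curvature P" and x: "r \<le> x"
  shows "u x \<le> r / x"
proof -
  have r: "0 < r" "u r = 1" using E unfolding end_profile_def by auto
  have "x * u x \<le> r * u r"
  proof (rule DERIV_nonpos_imp_decreasing_open[OF x])
    show "continuous_on {r..x} (\<lambda>x. x * u x)"
      using E unfolding end_profile_def by (intro continuous_intros) (auto intro: continuous_on_subset)
    fix z assume z: "r < z" "z < x"
    have "(u has_real_derivative 2 * P (sqrt (1 - (u z)\<^sup>2)) - u z / z) (at z)"
      using E z unfolding end_profile_def by auto
    then have "((\<lambda>x. x * u x) has_real_derivative 2 * z * P (sqrt (1 - (u z)\<^sup>2))) (at z)"
      using z r by (auto intro!: derivative_eq_intros simp: field_simps)
    moreover have "2 * z * P (sqrt (1 - (u z)\<^sup>2)) \<le> 0"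
      using end_profile_below_one(3)[OF E P z(1)] z r by (intro mult_nonneg_nonpos) auto
    ultimately show "\<exists>d. ((\<lambda>x. x * u x) has_real_derivative d) (at z) \<and> d \<le> 0" by blast
  qed
  then show ?thesis using r x by (simp add: field_simps)
qed

text \<open>
  By monotonicity and decay every slope strictly between the vertical and the horizontal one occurs
  exactly once, so the slope is a parameter of the end.
\<close>

lemma end_profile_inverse:
  assumes E: "end_profile P r u g" and P: "end_curvature P"
  obtains Y where
    "\<And>t. 0 < t \<Longrightarrow> t < 1 \<Longrightarrow> r < Y t \<and> u (Y t) = t"
    "\<And>t. 0 < t \<Longrightarrow> t < 1 \<Longrightarrow>
       (Y has_real_derivative inverse (2 * P (sqrt (1 - t\<^sup>2)) - t / Y t)) (at t)"
proof -
  have r: "0 < r" "u r = 1" and cu: "continuous_on {r..} u" using E unfolding end_profile_def by auto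
  have ex: "\<exists>y>r. u y = t" if t: "0 < t" "t < 1" for t
  proof -
    have le: "r \<le> r / t" using t r by (simp add: field_simps)
    have "u (r / t) \<le> t" using end_profile_decay[OF E P le] r by (simp add: field_simps)
    then have "\<exists>y\<ge>r. y \<le> r / t \<and> u y = t"
      using t r le cu by (intro IVT2') (auto intro: continuous_on_subset)
    then show ?thesis using t r by (metis order_le_less order_less_irrefl)
  qed
  define Y where "Y t = (SOME y. r < y \<and> u y = t)" for t
  have Y: "r < Y t \<and> u (Y t) = t" if "0 < t" "t < 1" for t
    unfolding Y_def using someI_ex[of "\<lambda>y. r < y \<and> u y = t"] ex[OF that] by blast
  have inj: "y = z" if "r < y" "r < z" "u y = u z" for y z
    using end_profile_decreasing[OF E P, of y z] end_profile_decreasing[OF E P, of z y] that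
    by (cases y z rule: linorder_cases) auto
  have Yu: "Y (u y) = y" if "r < y" for y
    using Y[of "u y"] end_profile_below_one[OF E P that] inj that by blast
  show thesis
  proof (rule that[of Y])
    fix t :: real assume t: "0 < t" "t < 1"
    define y where "y = Y t"
    have y: "r < y" "u y = t" using Y[OF t] by (auto simp: y_def)
    have "isCont Y (u y)"
    proof (rule isCont_inverse_function2[of "(r + y) / 2" y "y + 1"])
      show "\<And>z. (r + y) / 2 \<le> z \<Longrightarrow> z \<le> y + 1 \<Longrightarrow> Y (u z) = z" using Yu y by simp
      show "isCont u z" if "(r + y) / 2 \<le> z" "z \<le> y + 1" for z
      proof (rule DERIV_isCont)
        have "r < z" using that y by (simp add: field_simps)
        then show "(u has_real_derivative 2 * P (sqrt (1 - (u z)\<^sup>2)) - u z / z) (at z)"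
          using E unfolding end_profile_def by auto
      qed
    qed (use y in auto)
    then have c: "isCont Y t" using y by simp
    show "(Y has_real_derivative inverse (2 * P (sqrt (1 - t\<^sup>2)) - t / Y t)) (at t)"
    proof (rule DERIV_inverse_function[of u _ Y t 0 1])
      show "(u has_real_derivative 2 * P (sqrt (1 - t\<^sup>2)) - t / Y t) (at (Y t))"
        using E y unfolding end_profile_def y_def[symmetric] by metis
      have "P (sqrt (1 - t\<^sup>2)) < 0" "0 < t / Y t"
        using end_profile_below_one(3)[OF E P y(1)] y r t by (auto simp: y_def)
      then show "2 * P (sqrt (1 - t\<^sup>2)) - t / Y t \<noteq> 0" by linarith
    qed (use t c Y in auto)
  qed (use Y in auto)
qed

lemma end_profile_height_mono:
  assumes E: "end_profile P r u g" and P: "end_curvature P" and "r \<le> x" "x \<le> y"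
  shows "g x \<le> g y"
proof (rule DERIV_nonneg_imp_increasing_open[OF \<open>x \<le> y\<close>])
  show "continuous_on {x..y} g" using E assms unfolding end_profile_def by (auto intro: continuous_on_subset)
  fix z assume z: "x < z" "z < y"
  have "(g has_real_derivative u z / sqrt (1 - (u z)\<^sup>2)) (at z)"
    using E assms z unfolding end_profile_def by auto
  moreover have "0 \<le> u z / sqrt (1 - (u z)\<^sup>2)"
    using end_profile_below_one[OF E P, of z] z assms by (simp add: power_le_one)
  ultimately show "\<exists>d. (g has_real_derivative d) (at z) \<and> 0 \<le> d" by blast
qed

text \<open>
  Comparison at points of equal slope. Since \<open>P\<close> and \<open>Q\<close> are negative, the hypothesis says that the curvature
  term of the first end is at least \<open>a\<close> times that of the second one near a horizontal tangent plane;
  hence the first end flattens at least as fast as the second one, up to a constant factor. Working at equal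
  slopes avoids comparing values of \<open>P\<close> at different arguments, about which nothing is known
  because \<open>P\<close> need not be monotone near 1.
\<close>

theorem bounded_height_comparison:
  assumes E: "end_profile P r u f" and P: "end_curvature P"
    and E': "end_profile Q s v g" and Q: "end_curvature Q"
    and a: "0 < a" and PQ: "\<forall>\<^sub>F y in at_left 1. P y \<le> a * Q y"
    and bdd: "bounded (g ` {s<..})"
  shows "bounded (f ` {r<..})"
proof -
  have r: "0 < r" "u r = 1" and s: "0 < s" "v s = 1"
    using E E' unfolding end_profile_def by auto
  obtain d where d: "d < 1" "\<And>y. d < y \<Longrightarrow> y < 1 \<Longrightarrow> P y \<le> a * Q y"
    using PQ by (auto simp: eventually_at_left[of 0])
  obtain Y where Y: "\<And>t. 0 < t \<Longrightarrow> t < 1 \<Longrightarrow> s < Y t \<and> v (Y t) = t"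
    "\<And>t. 0 < t \<Longrightarrow> t < 1 \<Longrightarrow>
       (Y has_real_derivative inverse (2 * Q (sqrt (1 - t\<^sup>2)) - t / Y t)) (at t)"
    using end_profile_inverse[OF E' Q] by blast
  \<comment> \<open>the point of the second end at which it has the same slope as the first one at \<open>x\<close>\<close>
  define \<phi> where "\<phi> x = Y (u x)" for x
  have u: "0 < u x" "u x < 1" if "r < x" for x using end_profile_below_one[OF E P that] by auto
  have \<phi>: "s < \<phi> x" "v (\<phi> x) = u x" if "r < x" for x using Y(1) u[OF that] by (auto simp: \<phi>_def)
  define h k where "h x = - P (sqrt (1 - (u x)\<^sup>2))" and "k x = - Q (sqrt (1 - (u x)\<^sup>2))" for x
  have h: "0 < h x" if "r < x" for x using end_profile_below_one(3)[OF E P that] by (simp add: h_def)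
  have k: "0 < k x" if "r < x" for x
    using end_profile_below_one(3)[OF E' Q \<phi>(1)[OF that]] \<phi>(2)[OF that] by (simp add: k_def)
  define \<phi>' where "\<phi>' x = (u x / x + 2 * h x) / (u x / \<phi> x + 2 * k x)" for x
  have D\<phi>: "(\<phi> has_real_derivative \<phi>' x) (at x)" if x: "r < x" for x
  proof -
    have "(u has_real_derivative - (u x / x + 2 * h x)) (at x)"
      using E x unfolding end_profile_def h_def by (auto simp: algebra_simps)
    from DERIV_chain2[OF Y(2)[OF u[OF x]] this]
    have "(\<phi> has_real_derivative inverse (- (u x / \<phi> x + 2 * k x)) * - (u x / x + 2 * h x)) (at x)"
      unfolding \<phi>_def k_def by (simp add: algebra_simps)
    moreover have "inverse (- (u x / \<phi> x + 2 * k x)) * - (u x / x + 2 * h x) = \<phi>' x"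
      by (simp only: \<phi>'_def inverse_minus_eq minus_mult_minus) (simp only: divide_inverse mult.commute)
    ultimately show ?thesis by simp
  qed
  \<comment> \<open>The comparison of \<open>P\<close> and \<open>Q\<close> holds for slopes below \<open>t0\<close>, and \<open>u x \<le> r / x\<close> is such from \<open>x0\<close> on.\<close>
  define d' where "d' = max 0 d"
  define t0 where "t0 = sqrt (1 - d'\<^sup>2)"
  have d': "0 \<le> d'" "d' < 1" "d \<le> d'" using d by (auto simp: d'_def)
  then have t0: "0 < t0" by (auto simp: t0_def abs_square_less_1)
  define x0 where "x0 = max (r + 1) (r / t0 + 1)"
  have x0: "r < x0" by (simp add: x0_def)
  have hk: "a * k x \<le> h x" if x: "x0 \<le> x" for x
  proof -
    have rx: "r < x" using x x0 by simp
    have "r / t0 < x" using x by (simp add: x0_def)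
    then have "r / x < t0" using t0 rx r by (simp add: field_simps)
    then have "u x < t0" using end_profile_decay[OF E P, of x] rx by simp
    then have "(u x)\<^sup>2 < t0\<^sup>2" using u[OF rx] by (intro power_strict_mono) auto
    also have "t0\<^sup>2 = 1 - d'\<^sup>2" using d' by (simp add: t0_def power_le_one)
    finally have "d' < sqrt (1 - (u x)\<^sup>2)" using d' by (intro real_less_rsqrt) auto
    moreover have "sqrt (1 - (u x)\<^sup>2) < 1" using u[OF rx] by simp
    ultimately show ?thesis using d(2)[of "sqrt (1 - (u x)\<^sup>2)"] d' by (simp add: h_def k_def)
  qed
  \<comment> \<open>The first bound makes \<open>\<phi> x / x\<close> nondecreasing below \<open>1 / K\<close>, the second one is the start at \<open>x0\<close>.\<close>
  define K where "K = max (1 / a) (x0 / \<phi> x0)"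
  have "0 < 1 / a" using a by simp
  then have K: "0 < K" "1 / a \<le> K" "x0 / \<phi> x0 \<le> K" by (auto simp: K_def less_max_iff_disj)
  then have aK: "1 \<le> a * K" using a by (simp add: field_simps)
  have pos: "0 < x" "0 < \<phi> x" if "x0 \<le> x" for x using \<phi>(1)[of x] that x0 r s by auto
  have ratio: "1 / K \<le> \<phi> x / x" if x: "x0 \<le> x" for x
  proof (rule barrier[OF x])
    have D: "((\<lambda>x. \<phi> x / x) has_real_derivative (\<phi>' y * y - \<phi> y) / (y * y)) (at y)" if "x0 \<le> y" for y
      using pos[OF that] that x0 by (auto intro!: derivative_eq_intros D\<phi>)
    show "continuous_on {x0..x} (\<lambda>x. \<phi> x / x)"
      by (rule continuous_at_imp_continuous_on) (auto intro: DERIV_isCont[OF D])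
    show "1 / K \<le> \<phi> x0 / x0" using K pos[of x0] by (simp add: field_simps)
    fix y assume y: "x0 < y" "y < x"
    show "((\<lambda>x. \<phi> x / x) has_real_derivative (\<phi>' y * y - \<phi> y) / (y * y)) (at y)"
      using D y by simp
    have ry: "r < y" using y x0 by simp
    note p = pos[of y] h[OF ry] k[OF ry] u[OF ry]
    assume "\<phi> y / y < 1 / K"
    then have "K * \<phi> y \<le> y" using p y K by (simp add: field_simps)
    have "k y * \<phi> y \<le> (a * K) * (k y * \<phi> y)"
      using aK p y by (intro mult_right_mono[of 1 "a * K", simplified]) auto
    also have "\<dots> = (a * k y) * (K * \<phi> y)" by simp
    also have "\<dots> \<le> h y * y" using hk[of y] \<open>K * \<phi> y \<le> y\<close> p y K by (intro mult_mono) auto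
    \<comment> \<open>this is \<open>\<phi>' / \<phi> \<ge> 1 / y\<close>, cleared of denominators\<close>
    finally have *: "k y * \<phi> y \<le> h y * y" .
    have "\<phi> y * (u y / \<phi> y + 2 * k y) \<le> (u y / y + 2 * h y) * y"
      using * p y by (simp add: algebra_simps)
    moreover have "0 < u y / \<phi> y + 2 * k y" using p y by (intro add_pos_pos) auto
    ultimately have "\<phi> y \<le> \<phi>' y * y" by (simp add: \<phi>'_def field_simps)
    then show "0 \<le> (\<phi>' y * y - \<phi> y) / (y * y)" by simp
  qed
  have \<phi>'_ge: "1 \<le> K * \<phi>' x" if x: "x0 \<le> x" for x
  proof -
    have rx: "r < x" using x x0 by simp
    note p = pos[OF x] h[OF rx] k[OF rx] u[OF rx]
    have "u x / \<phi> x \<le> K * (u x / x)" using ratio[OF x] p K by (simp add: field_simps)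
    moreover have "k x \<le> K * h x"
    proof -
      have "k x \<le> (a * K) * k x" using aK p by simp
      also have "\<dots> = K * (a * k x)" by simp
      also have "\<dots> \<le> K * h x" using hk[OF x] K by (intro mult_left_mono) auto
      finally show ?thesis .
    qed
    ultimately have "u x / \<phi> x + 2 * k x \<le> K * (u x / x + 2 * h x)" by (simp add: algebra_simps)
    moreover have "0 < u x / \<phi> x + 2 * k x" using p by (intro add_pos_pos) auto
    ultimately show ?thesis by (simp add: \<phi>'_def field_simps)
  qed
  obtain B where B: "\<And>y. s < y \<Longrightarrow> g y \<le> B"
    using bdd unfolding bounded_iff by (metis abs_le_D1 greaterThan_iff image_eqI real_norm_def)
  define C where "C = f x0 - K * g (\<phi> x0) + K * B"
  have up: "f x \<le> C" if x: "x0 \<le> x" for x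
  proof -
    have D: "((\<lambda>x. f x - K * g (\<phi> x)) has_real_derivative
        u y / sqrt (1 - (u y)\<^sup>2) - K * (u y / sqrt (1 - (u y)\<^sup>2) * \<phi>' y)) (at y)" if "x0 \<le> y" for y
    proof -
      have ry: "r < y" using that x0 by simp
      have "(f has_real_derivative u y / sqrt (1 - (u y)\<^sup>2)) (at y)"
        using E ry unfolding end_profile_def by auto
      moreover have "(g has_real_derivative u y / sqrt (1 - (u y)\<^sup>2)) (at (\<phi> y))"
        using E' \<phi>[OF ry] unfolding end_profile_def by metis
      then have "((\<lambda>x. g (\<phi> x)) has_real_derivative u y / sqrt (1 - (u y)\<^sup>2) * \<phi>' y) (at y)"
        using D\<phi>[OF ry] by (rule DERIV_chain2)
      ultimately show ?thesis by (intro DERIV_diff DERIV_cmult)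
    qed
    have "f x - K * g (\<phi> x) \<le> f x0 - K * g (\<phi> x0)"
    proof (rule DERIV_nonpos_imp_nonincreasing[OF x])
      fix y assume y: "x0 \<le> y" "y \<le> x"
      then have "r < y" using x0 by simp
      then have "0 \<le> u y / sqrt (1 - (u y)\<^sup>2)" using u[of y] by (simp add: power_le_one)
      then have "u y / sqrt (1 - (u y)\<^sup>2) * 1 \<le> u y / sqrt (1 - (u y)\<^sup>2) * (K * \<phi>' y)"
        using \<phi>'_ge[OF y(1)] by (intro mult_left_mono)
      then show "\<exists>d. ((\<lambda>x. f x - K * g (\<phi> x)) has_real_derivative d) (at y) \<and> d \<le> 0"
        using D[OF y(1)] by (intro exI conjI) (assumption, simp add: algebra_simps)
    qed
    moreover have "K * g (\<phi> x) \<le> K * B" using B[OF \<phi>(1)] x x0 K by (intro mult_left_mono) auto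
    ultimately show ?thesis by (simp add: C_def)
  qed
  have "f ` {r<..} \<subseteq> {f r..max C (f x0)}"
  proof safe
    fix x assume "r < x"
    then have "f r \<le> f x" using end_profile_height_mono[OF E P, of r x] by simp
    moreover have "f x \<le> max C (f x0)"
    proof (cases "x0 \<le> x")
      case False
      then have "f x \<le> f x0" using end_profile_height_mono[OF E P, of x x0] \<open>r < x\<close> by simp
      then show ?thesis by simp
    qed (use up in fastforce)
    ultimately show "f x \<in> {f r..max C (f x0)}" by simp
  qed
  then show ?thesis by (rule bounded_subset[rotated]) simp
qed

section \<open>Graphs over the plane and charts\<close>

definition graph_lift :: "(real \<Rightarrow> real) \<Rightarrow> real \<times> real \<Rightarrow> real^3" where
  "graph_lift f z = vector [fst z, snd z, f (norm z)]"

lemma graph_lift_nth [simp]: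
  "graph_lift f z $ 1 = fst z" "graph_lift f z $ 2 = snd z" "graph_lift f z $ 3 = f (norm z)"
  by (simp_all add: graph_lift_def)

lemma axis_dist_graph_lift [simp]: "axis_dist (graph_lift f z) = norm z"
  by (cases z) (simp add: axis_dist_def norm_Pair)

lemma graph_lift_in_rotated_graph: "r \<le> norm z \<Longrightarrow> graph_lift f z \<in> rotated_graph r f"
  by (simp add: rotated_graph_def)

lemma isCont_graph_lift:
  assumes "continuous_on {r..} f" "r < norm z"
  shows "isCont (graph_lift f) z"
proof -
  have "isCont f (norm z)"
    using assms by (auto intro!: continuous_on_interior)
  then have "isCont (\<lambda>z. f (norm z)) z"
    by (intro isCont_o2[of z norm f]) (auto intro: continuous_intros)
  then have "\<forall>i. isCont (\<lambda>z. graph_lift f z $ i) z"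
    unfolding forall_3 graph_lift_nth by (intro conjI continuous_intros)
  then show ?thesis unfolding isCont_def by (intro vec_tendstoI) auto
qed

definition proj_xy :: "real^3 \<Rightarrow> real \<times> real" where
  "proj_xy p = (p $ 1, p $ 2)"

lemma bounded_linear_proj_xy: "bounded_linear proj_xy"
  unfolding proj_xy_def by (intro bounded_linear_Pair bounded_linear_vec_nth)

lemma proj_xy_graph_lift [simp]: "proj_xy (graph_lift f z) = z"
  by (simp add: proj_xy_def)

lemma has_derivative_cong_nhds:
  assumes "(f has_derivative f') (at x)" "\<forall>\<^sub>F y in nhds x. f y = g y"
  shows "(g has_derivative f') (at x)"
  using assms has_derivative_transform_within_open unfolding eventually_nhds by blast

lemma local_chart_has_derivative:
  assumes "local_chart S V X" "q \<in> V"
  shows "(X has_derivative frechet_derivative X (at q)) (at q)"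
  using assms unfolding local_chart_def C2_on_def frechet_derivative_works[symmetric]
  by (auto simp: differentiable_def)

text \<open>
  The chart in the coordinates of the graph. The normal is not horizontal, so the vertical direction
  is not tangent and the projected chart has an invertible derivative at \<open>q\<close>. Its local inverse
  \<open>\<Phi>\<close> is the inverse of the chart composed with the lift to the graph, hence continuous; a continuous local
  inverse is differentiable where the derivative is invertible. In this way the graph is seen to be
  differentiable, which is not part of the definition of a bigraph.
\<close>

lemma graph_coordinates_of_chart:
  fixes X :: "real \<times> real \<Rightarrow> real^3"
  assumes chart: "local_chart S V X" and q: "q \<in> V" "X q = graph_lift f z0"
    and cont: "isCont (graph_lift f) z0" and mem: "\<forall>\<^sub>F z in nhds z0. graph_lift f z \<in> S"
    and normal: "\<And>w. \<nu> \<bullet> frechet_derivative X (at q) w = 0" and \<nu>: "\<nu> $ 3 \<noteq> 0"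
  obtains \<Phi> \<Phi>' where
    "(\<Phi> has_derivative \<Phi>') (at z0)" "\<Phi> z0 = q" "\<forall>\<^sub>F z in nhds z0. X (\<Phi> z) = graph_lift f z"
    "\<forall>w. \<Phi>' (proj_xy (frechet_derivative X (at q) w)) = w"
    "\<forall>w. proj_xy (frechet_derivative X (at q) (\<Phi>' w)) = w"
proof -
  let ?X' = "frechet_derivative X (at q)" and ?G = "graph_lift f"
  note DX = local_chart_has_derivative[OF chart q(1)]
  interpret X': bounded_linear ?X' using DX by (rule has_derivative_bounded_linear)
  have DpX: "((\<lambda>z. proj_xy (X z)) has_derivative (\<lambda>w. proj_xy (?X' w))) (at q)"
    using bounded_linear.has_derivative[OF bounded_linear_proj_xy DX] .
  have lin: "linear (\<lambda>w. proj_xy (?X' w))"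
    using has_derivative_bounded_linear[OF DpX] by (rule bounded_linear.linear)
  have "inj (\<lambda>w. proj_xy (?X' w))"
  proof (subst linear_injective_0[OF lin], intro allI impI)
    fix w assume w: "proj_xy (?X' w) = 0"
    then have "?X' w $ 1 = 0" "?X' w $ 2 = 0" by (auto simp: proj_xy_def zero_prod_def)
    moreover from this have "?X' w $ 3 = 0"
      using normal[of w] \<nu> by (simp add: inner_vec_def sum_3)
    ultimately have "?X' w = ?X' 0" unfolding X'.zero by (simp add: vec_eq_iff forall_3)
    moreover have "inj ?X'" using chart q unfolding local_chart_def by blast
    ultimately show "w = 0" by (rule injD[rotated])
  qed
  then obtain \<Phi>' where \<Phi>': "linear \<Phi>'" "\<And>w. \<Phi>' (proj_xy (?X' w)) = w" "\<And>w. proj_xy (?X' (\<Phi>' w)) = w"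
    using linear_injective_isomorphism[OF lin] by blast
  obtain Y where Y: "homeomorphism V (X ` V) X Y" using chart unfolding local_chart_def by blast
  define \<Phi> where "\<Phi> z = Y (?G z)" for z
  obtain U where U: "open U" "X ` V = S \<inter> U"
    using chart unfolding local_chart_def openin_open by blast
  have "X q \<in> X ` V" using q(1) by (rule imageI)
  then have "?G z0 \<in> U" unfolding U(2) q(2) by simp
  have "\<forall>\<^sub>F z in nhds z0. ?G z \<in> U"
    using cont U(1) \<open>?G z0 \<in> U\<close>
    unfolding isCont_def tendsto_at_iff_tendsto_nhds by (rule topological_tendstoD)
  with mem have "\<forall>\<^sub>F z in nhds z0. ?G z \<in> X ` V"
    by eventually_elim (simp add: U)
  then obtain W where W: "open W" "z0 \<in> W" "\<And>z. z \<in> W \<Longrightarrow> ?G z \<in> X ` V"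
    by (auto simp: eventually_nhds)
  have X\<Phi>: "X (\<Phi> z) = ?G z" if "z \<in> W" for z
    using W(3)[OF that] Y by (auto simp: \<Phi>_def homeomorphism_def)
  have \<Phi>q: "\<Phi> z0 = q" using Y q by (simp add: \<Phi>_def flip: q(2)) (metis homeomorphism_apply1)
  have "(Y \<longlongrightarrow> Y (?G z0)) (at (?G z0) within X ` V)"
    using homeomorphism_cont2[OF Y] W(3)[OF W(2)] unfolding continuous_on_def by (rule bspec)
  moreover have "filterlim ?G (at (?G z0) within X ` V) (at z0)"
    unfolding filterlim_at
  proof
    show "(?G \<longlongrightarrow> ?G z0) (at z0)" using cont by (simp add: isCont_def)
    show "\<forall>\<^sub>F z in at z0. ?G z \<in> X ` V \<and> ?G z \<noteq> ?G z0"
    proof -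
      have "\<forall>\<^sub>F z in at z0. z \<in> W" "\<forall>\<^sub>F z in at z0. z \<noteq> z0"
        using W by (auto intro: eventually_at_in_open' eventually_neq_at_within)
      then show ?thesis
        by eventually_elim (use W(3) proj_xy_graph_lift in metis)
    qed
  qed
  ultimately have cont\<Phi>: "isCont \<Phi> z0"
    unfolding \<Phi>_def isCont_def by (rule filterlim_compose)
  have "(\<Phi> has_derivative \<Phi>') (at z0)"
  proof (rule has_derivative_inverse_basic[where f = "\<lambda>z. proj_xy (X z)" and T = W])
    show "((\<lambda>z. proj_xy (X z)) has_derivative (\<lambda>w. proj_xy (?X' w))) (at (\<Phi> z0))"
      using DpX \<Phi>q by simp
    show "bounded_linear \<Phi>'" using \<Phi>'(1) by (simp add: linear_conv_bounded_linear)
    show "\<Phi>' \<circ> (\<lambda>w. proj_xy (?X' w)) = id" using \<Phi>'(2) by auto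
    show "proj_xy (X (\<Phi> z)) = z" if "z \<in> W" for z using X\<Phi>[OF that] by simp
  qed (fact cont\<Phi> W)+
  moreover have "\<forall>\<^sub>F z in nhds z0. X (\<Phi> z) = ?G z"
    unfolding eventually_nhds using W(1,2) X\<Phi> by blast
  ultimately show thesis using that[of \<Phi> \<Phi>'] \<Phi>q \<Phi>' by simp
qed

text \<open>
  The trace of a diagonal matrix, for a basis of eigenvectors \<open>(a1, b1)\<close> and \<open>(a2, b2)\<close>.
\<close>

lemma sum_of_eigenvalues_of_diagonal:
  fixes \<alpha> \<beta> :: real
  assumes "\<alpha> * a1 = k1 * a1" "\<beta> * b1 = k1 * b1" "\<alpha> * a2 = k2 * a2" "\<beta> * b2 = k2 * b2"
    and "a1 * b2 \<noteq> a2 * b1"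
  shows "\<alpha> + \<beta> = k1 + k2"
  using assms by (cases "a1 * b2 = 0") auto

section \<open>The profile equation of a rotational surface\<close>

text \<open>
  One of the two ends: the upper one for \<open>\<sigma> = 1\<close>, the lower one for \<open>\<sigma> = -1\<close>.
\<close>

locale rotational_sheet =
  fixes H :: "real \<Rightarrow> real" and S :: "(real^3) set" and \<eta> :: "real^3 \<Rightarrow> real^3"
    and r \<sigma> :: real and f :: "real \<Rightarrow> real"
  assumes H_surface: "H_surface H S \<eta>" and r_pos: "0 < r" and sign: "\<sigma> = 1 \<or> \<sigma> = -1"
    and cont: "continuous_on {r..} f" and graph: "rotated_graph r f \<subseteq> S"
    and waist: "\<eta> (graph_lift f (r, 0)) $ 1 = -1"
    and side: "\<And>z. r < norm z \<Longrightarrow> 0 < \<sigma> * \<eta> (graph_lift f z) $ 3"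
begin

abbreviation G where "G \<equiv> graph_lift f"

text \<open>
  The sine of the angle of inclination of the curve \<open>\<sigma> * f\<close>. It is expressed by the normal because
  the normal is known to be continuous up to the waist and to be differentiable in a chart, while \<open>f\<close> is only
  known to be continuous.
\<close>

definition slope_sine :: "real \<Rightarrow> real" where
  "slope_sine x = - \<eta> (G (x, 0)) $ 1"

lemma G_mem: "r \<le> norm z \<Longrightarrow> G z \<in> S"
  using graph graph_lift_in_rotated_graph by blast

lemma G_mem_eventually: "r < norm z0 \<Longrightarrow> \<forall>\<^sub>F z in nhds z0. G z \<in> S"
proof -
  assume "r < norm z0"
  moreover have "open {z::real\<times>real. r < norm z}" by (intro open_Collect_less continuous_intros)
  ultimately have "\<forall>\<^sub>F z in nhds z0. r < norm z" by (auto simp: eventually_nhds)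
  then show ?thesis by eventually_elim (simp add: G_mem)
qed

lemma chart_coordinates:
  assumes z0: "r < norm z0" and chart: "local_chart S V X" "q \<in> V" "X q = G z0"
  obtains \<Phi> \<Phi>' where
    "(\<Phi> has_derivative \<Phi>') (at z0)" "\<Phi> z0 = q" "\<forall>\<^sub>F z in nhds z0. X (\<Phi> z) = G z"
    "\<forall>w. \<Phi>' (proj_xy (frechet_derivative X (at q) w)) = w"
    "\<forall>w. proj_xy (frechet_derivative X (at q) (\<Phi>' w)) = w"
    "(G has_derivative (\<lambda>w. frechet_derivative X (at q) (\<Phi>' w))) (at z0)"
    "\<forall>w. \<eta> (G z0) \<bullet> frechet_derivative X (at q) w = 0"
proof -
  have N: "\<forall>w. \<eta> (G z0) \<bullet> frechet_derivative X (at q) w = 0"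
  proof
    fix w
    have "frechet_derivative X (at q) w \<in> tangent_plane S (G z0)"
      unfolding tangent_plane_def using chart by blast
    then show "\<eta> (G z0) \<bullet> frechet_derivative X (at q) w = 0"
      using H_surface G_mem[of z0] z0 unfolding H_surface_def unit_normal_def by simp
  qed
  have n3: "\<eta> (G z0) $ 3 \<noteq> 0" using side[OF z0] by auto
  obtain \<Phi> \<Phi>' where \<Phi>: "(\<Phi> has_derivative \<Phi>') (at z0)" "\<Phi> z0 = q" "\<forall>\<^sub>F z in nhds z0. X (\<Phi> z) = G z"
    "\<forall>w. \<Phi>' (proj_xy (frechet_derivative X (at q) w)) = w"
    "\<forall>w. proj_xy (frechet_derivative X (at q) (\<Phi>' w)) = w"
    by (rule graph_coordinates_of_chart[OF chart isCont_graph_lift[OF cont z0] G_mem_eventually[OF z0] spec[OF N] n3])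
  have DX: "(X has_derivative frechet_derivative X (at q)) (at (\<Phi> z0))"
    using local_chart_has_derivative[OF chart(1,2)] \<Phi>(2) by simp
  have "((\<lambda>z. X (\<Phi> z)) has_derivative (\<lambda>w. frechet_derivative X (at q) (\<Phi>' w))) (at z0)"
    using has_derivative_compose[OF \<Phi>(1) DX] .
  then have "(G has_derivative (\<lambda>w. frechet_derivative X (at q) (\<Phi>' w))) (at z0)"
    using \<Phi>(3) by (rule has_derivative_cong_nhds)
  from that[of \<Phi> \<Phi>', OF \<Phi> this N] show thesis .
qed

lemma G_differentiable:
  assumes "r < norm z0"
  obtains D where "(G has_derivative D) (at z0)" "\<forall>w. proj_xy (D w) = w" "\<forall>w. \<eta> (G z0) \<bullet> D w = 0"
proof -
  have "G z0 \<in> S" using G_mem assms by simp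
  then obtain V X q where chart: "local_chart S V X" "q \<in> V" "X q = G z0"
    using H_surface unfolding H_surface_def regular_surface_def by (metis imageE)
  obtain \<Phi> \<Phi>' where "(\<Phi> has_derivative \<Phi>') (at z0)" "\<Phi> z0 = q" "\<forall>\<^sub>F z in nhds z0. X (\<Phi> z) = G z"
    "\<forall>w. \<Phi>' (proj_xy (frechet_derivative X (at q) w)) = w"
    and D: "\<forall>w. proj_xy (frechet_derivative X (at q) (\<Phi>' w)) = w"
    "(G has_derivative (\<lambda>w. frechet_derivative X (at q) (\<Phi>' w))) (at z0)"
    and N: "\<forall>w. \<eta> (G z0) \<bullet> frechet_derivative X (at q) w = 0"
    by (rule chart_coordinates[OF assms chart])
  have "\<forall>w. \<eta> (G z0) \<bullet> frechet_derivative X (at q) (\<Phi>' w) = 0"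
  proof
    show "\<eta> (G z0) \<bullet> frechet_derivative X (at q) (\<Phi>' w) = 0" for w
      using spec[OF N, of "\<Phi>' w"] .
  qed
  from that[of "\<lambda>w. frechet_derivative X (at q) (\<Phi>' w)", OF D(2,1) this] show thesis .
qed

lemma profile_differentiable:
  assumes x: "r < x"
  shows "f differentiable (at x)"
proof -
  have "r < norm (x, 0 :: real)" using x r_pos by simp
  then obtain D where "(G has_derivative D) (at (x, 0))" by (rule G_differentiable)
  then have "((\<lambda>z. G z $ 3) has_derivative (\<lambda>w. D w $ 3)) (at (x, 0))"
    by (rule bounded_linear.has_derivative[OF bounded_linear_vec_nth])
  moreover have "((\<lambda>t::real. (t, 0 :: real)) has_derivative (\<lambda>t. (t, 0))) (at x)"
    by (auto intro!: derivative_eq_intros)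
  ultimately have "((\<lambda>t. G (t, 0) $ 3) has_derivative (\<lambda>t. D (t, 0) $ 3)) (at x)"
    using has_derivative_compose[of "\<lambda>t::real. (t, 0 :: real)" "\<lambda>t. (t, 0)" x UNIV "\<lambda>z. G z $ 3"] by simp
  then have "(\<lambda>t. f \<bar>t\<bar>) differentiable (at x)" by (auto simp: differentiable_def)
  moreover have "\<forall>\<^sub>F t in nhds x. f \<bar>t\<bar> = f t"
    using eventually_gt_at_top x r_pos
    by (auto simp: eventually_nhds intro!: exI[of _ "{0<..}"])
  ultimately show ?thesis
    unfolding differentiable_def using has_derivative_cong_nhds by blast
qed

text \<open>
  The profile is differentiable, hence the tangent plane is spanned by the partial derivatives of
  the graph of \<open>f (norm z)\<close>, and a unit vector orthogonal to it with third component of sign \<open>\<sigma>\<close> is unique. This yields the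
  rotational symmetry of the normal without using rotations.
\<close>

lemma normal_on_sheet:
  fixes a b :: real
  defines "\<rho> \<equiv> norm (a, b)"
  assumes z: "r < \<rho>"
  shows "\<eta> (G (a, b)) $ 1 = - slope_sine \<rho> * a / \<rho>"
    and "\<eta> (G (a, b)) $ 2 = - slope_sine \<rho> * b / \<rho>"
    and "\<eta> (G (a, b)) $ 3 = \<sigma> * sqrt (1 - (slope_sine \<rho>)\<^sup>2)"
    and "\<bar>slope_sine \<rho>\<bar> < 1"
    and "(f has_real_derivative \<sigma> * slope_sine \<rho> / sqrt (1 - (slope_sine \<rho>)\<^sup>2)) (at \<rho>)"
proof -
  have \<rho>: "0 < \<rho>" using z r_pos by simp
  obtain m where m: "(f has_real_derivative m) (at \<rho>)"
    using profile_differentiable[OF z] by (auto simp: real_differentiable_def)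
  have eta: "\<eta> (G (c, d)) $ 1 = - \<eta> (G (c, d)) $ 3 * m * c / \<rho>"
            "\<eta> (G (c, d)) $ 2 = - \<eta> (G (c, d)) $ 3 * m * d / \<rho>"
            "\<eta> (G (c, d)) $ 3 = \<sigma> / sqrt (1 + m\<^sup>2)"
    if cd: "norm (c, d) = \<rho>" for c d
  proof -
    have r: "r < norm (c, d)" using z cd by simp
    obtain D where D: "(G has_derivative D) (at (c, d))" "\<forall>w. proj_xy (D w) = w"
        "\<forall>w. \<eta> (G (c, d)) \<bullet> D w = 0"
      by (rule G_differentiable[OF r])
    have "((\<lambda>z. G z $ 3) has_derivative (\<lambda>w. D w $ 3)) (at (c, d))"
      using D(1) by (rule bounded_linear.has_derivative[OF bounded_linear_vec_nth])
    then have "((\<lambda>z. f (norm z)) has_derivative (\<lambda>w. D w $ 3)) (at (c, d))" by simp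
    moreover have "((\<lambda>z. f (norm z)) has_derivative (\<lambda>w. m * (w \<bullet> sgn (c, d)))) (at (c, d))"
    proof -
      have "(norm has_derivative (\<lambda>w. w \<bullet> sgn (c, d))) (at (c, d))"
        using cd \<rho> by (intro has_derivative_norm) auto
      moreover have "(f has_derivative (\<lambda>t. m * t)) (at (norm (c, d)))"
        using m cd by (simp add: has_field_derivative_def)
      ultimately show ?thesis by (rule has_derivative_compose)
    qed
    ultimately have D3: "D w $ 3 = m * (w \<bullet> sgn (c, d))" for w
      by (metis has_derivative_unique)
    have D12: "D w $ 1 = fst w" "D w $ 2 = snd w" for w
      using D(2)[rule_format, of w] by (auto simp: proj_xy_def prod_eq_iff)
    have e: "\<eta> (G (c, d)) $ 1 * fst w + \<eta> (G (c, d)) $ 2 * snd w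
        + \<eta> (G (c, d)) $ 3 * (m * (fst w * c / \<rho> + snd w * d / \<rho>)) = 0" for w
      using D(3)[rule_format, of w] cd
      by (cases w) (simp add: inner_vec_def sum_3 D12 D3 sgn_div_norm divide_inverse algebra_simps)
    show e1: "\<eta> (G (c, d)) $ 1 = - \<eta> (G (c, d)) $ 3 * m * c / \<rho>" using e[of "(1, 0)"] by simp
    show e2: "\<eta> (G (c, d)) $ 2 = - \<eta> (G (c, d)) $ 3 * m * d / \<rho>" using e[of "(0, 1)"] by simp
    have "norm (\<eta> (G (c, d))) = 1"
      using H_surface G_mem[of "(c, d)"] r unfolding H_surface_def unit_normal_def by simp
    then have "(\<eta> (G (c, d)) $ 1)\<^sup>2 + (\<eta> (G (c, d)) $ 2)\<^sup>2 + (\<eta> (G (c, d)) $ 3)\<^sup>2 = 1"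
      by (simp add: norm_eq_1 inner_vec_def sum_3 power2_eq_square)
    moreover have "c\<^sup>2 + d\<^sup>2 = \<rho>\<^sup>2" using cd by (simp add: norm_Pair flip: cd)
    then have "(c / \<rho>)\<^sup>2 + (d / \<rho>)\<^sup>2 = 1" using \<rho> by (simp add: power_divide flip: add_divide_distrib)
    moreover have "(\<eta> (G (c, d)) $ 1)\<^sup>2 + (\<eta> (G (c, d)) $ 2)\<^sup>2 
        = (\<eta> (G (c, d)) $ 3 * m)\<^sup>2 * ((c / \<rho>)\<^sup>2 + (d / \<rho>)\<^sup>2)"
      unfolding e1 e2 by (simp add: power_divide power_mult_distrib algebra_simps)
    ultimately have sq: "(\<eta> (G (c, d)) $ 3)\<^sup>2 * (1 + m\<^sup>2) = 1"
      by (simp add: power_mult_distrib algebra_simps)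
    have m1: "0 < 1 + m\<^sup>2" by (simp add: add_pos_nonneg)
    have "(\<sigma> * \<eta> (G (c, d)) $ 3)\<^sup>2 = 1 / (1 + m\<^sup>2)"
      using sq m1 sign by (auto simp: field_simps)
    then have "\<sigma> * \<eta> (G (c, d)) $ 3 = 1 / sqrt (1 + m\<^sup>2)"
      using side[OF r] by (metis real_sqrt_divide real_sqrt_one real_sqrt_unique less_imp_le)
    then show "\<eta> (G (c, d)) $ 3 = \<sigma> / sqrt (1 + m\<^sup>2)" using sign by auto
  qed
  have m1: "0 < 1 + m\<^sup>2" by (simp add: add_pos_nonneg)
  have n0: "norm (\<rho>, 0::real) = \<rho>" using \<rho> by simp
  have u: "slope_sine \<rho> = \<sigma> * m / sqrt (1 + m\<^sup>2)"
    using eta(1)[OF n0] eta(3)[OF n0] \<rho> by (simp add: slope_sine_def)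
  have u2: "1 - (slope_sine \<rho>)\<^sup>2 = 1 / (1 + m\<^sup>2)"
  proof -
    have "(slope_sine \<rho>)\<^sup>2 = m\<^sup>2 / (1 + m\<^sup>2)"
      unfolding u using m1 sign by (auto simp: power_divide)
    then show ?thesis using m1 by (simp add: field_simps)
  qed
  then have w: "sqrt (1 - (slope_sine \<rho>)\<^sup>2) = 1 / sqrt (1 + m\<^sup>2)" by (simp add: real_sqrt_divide)
  have n: "norm (a, b) = \<rho>" by (simp add: \<rho>_def)
  show "\<eta> (G (a, b)) $ 1 = - slope_sine \<rho> * a / \<rho>" using eta(1,3)[OF n] u by simp
  show "\<eta> (G (a, b)) $ 2 = - slope_sine \<rho> * b / \<rho>" using eta(2,3)[OF n] u by simp
  show "\<eta> (G (a, b)) $ 3 = \<sigma> * sqrt (1 - (slope_sine \<rho>)\<^sup>2)" using eta(3)[OF n] w by simp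
  have "0 < 1 - (slope_sine \<rho>)\<^sup>2" using u2 m1 by simp
  then show "\<bar>slope_sine \<rho>\<bar> < 1" by (simp add: abs_square_less_1)
  have "\<sigma> * slope_sine \<rho> / sqrt (1 - (slope_sine \<rho>)\<^sup>2) = m"
    unfolding w unfolding u using m1 sign by auto
  then show "(f has_real_derivative \<sigma> * slope_sine \<rho> / sqrt (1 - (slope_sine \<rho>)\<^sup>2)) (at \<rho>)"
    using m by simp
qed

text \<open>
  The derivative \<open>M\<close> of the normal over the point \<open>(x, 0)\<close>, projected to the plane, is diagonal: along the
  radius it is \<open>- u'\<close>, and along the circle it is \<open>- u / x\<close> because the normal turns with
  the circle. The projections of the principal directions are a basis of eigenvectors of this
  diagonal matrix, whose trace is therefore minus twice the mean curvature.
\<close>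

lemma profile_equation:
  assumes x: "r < x"
  shows "(slope_sine has_real_derivative
           2 * H (\<sigma> * sqrt (1 - (slope_sine x)\<^sup>2)) - slope_sine x / x) (at x)"
proof -
  let ?z = "(x, 0 :: real)"
  have x0: "0 < x" using x r_pos by simp
  have nz: "r < norm ?z" using x x0 by simp
  have "has_mean_curvature S \<eta> (G ?z) (H (\<eta> (G ?z) \<bullet> axis 3 1))"
    using H_surface G_mem[of ?z] nz unfolding H_surface_def by simp
  then obtain k1 k2 where k: "principal_curvatures S \<eta> (G ?z) k1 k2"
      and Hk: "2 * H (\<eta> (G ?z) $ 3) = k1 + k2"
    by (auto simp: has_mean_curvature_def inner_axis)
  define dX where "dX X q = frechet_derivative X (at q)" for X :: "real \<times> real \<Rightarrow> real^3" and q
  obtain V X q w1 w2 where chart: "local_chart S V X" "q \<in> V" "X q = G ?z"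
      and diff: "(\<eta> \<circ> X) differentiable (at q)"
      and w: "norm (dX X q w1) = 1" "norm (dX X q w2) = 1" "dX X q w1 \<bullet> dX X q w2 = 0"
        "- dX (\<eta> \<circ> X) q w1 = k1 *\<^sub>R dX X q w1" "- dX (\<eta> \<circ> X) q w2 = k2 *\<^sub>R dX X q w2"
    using k unfolding principal_curvatures_def Let_def dX_def[symmetric]
    by (elim exE conjE)
  obtain \<Phi> \<Phi>' where \<Phi>: "(\<Phi> has_derivative \<Phi>') (at ?z)" "\<Phi> ?z = q"
      "\<forall>\<^sub>F z in nhds ?z. X (\<Phi> z) = G z" "\<forall>w. \<Phi>' (proj_xy (dX X q w)) = w"
      "\<forall>w. proj_xy (dX X q (\<Phi>' w)) = w"
      "(G has_derivative (\<lambda>w. dX X q (\<Phi>' w))) (at ?z)"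
      "\<forall>w. \<eta> (G ?z) \<bullet> dX X q w = 0"
    unfolding dX_def by (rule chart_coordinates[OF nz chart])
  define M where "M w = dX (\<eta> \<circ> X) q (\<Phi>' w)" for w
  have DN: "((\<eta> \<circ> X) has_derivative dX (\<eta> \<circ> X) q) (at (\<Phi> ?z))"
    using diff \<Phi>(2) by (simp add: dX_def frechet_derivative_works)
  have "((\<lambda>z. (\<eta> \<circ> X) (\<Phi> z)) has_derivative M) (at ?z)"
    unfolding M_def using has_derivative_compose[OF \<Phi>(1) DN] .
  moreover have "\<forall>\<^sub>F z in nhds ?z. (\<eta> \<circ> X) (\<Phi> z) = \<eta> (G z)"
    using \<Phi>(3) by eventually_elim simp
  ultimately have DM: "((\<lambda>z. \<eta> (G z)) has_derivative M) (at ?z)"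
    by (rule has_derivative_cong_nhds)
  then interpret M: bounded_linear M by (rule has_derivative_bounded_linear)
  have DMi: "((\<lambda>z. \<eta> (G z) $ i) has_derivative (\<lambda>w. M w $ i)) (at ?z)" for i
    using DM by (rule bounded_linear.has_derivative[OF bounded_linear_vec_nth])
  define u' where "u' = - M (1, 0) $ 1"
  let ?u = slope_sine
  \<comment> \<open>The normal is differentiable in the chart that carries the principal curvatures, hence so is \<open>u\<close>.\<close>
  have Du: "(?u has_real_derivative u') (at x)"
  proof -
    have "((\<lambda>t::real. (t, 0 :: real)) has_derivative (\<lambda>t. (t, 0))) (at x)"
      by (auto intro!: derivative_eq_intros)
    from has_derivative_compose[OF this DMi[of 1]]
    have "((\<lambda>t. - \<eta> (G (t, 0)) $ 1) has_derivative (\<lambda>t. - M (t, 0) $ 1)) (at x)"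
      by (rule has_derivative_minus)
    moreover have "(\<lambda>t. - M (t, 0) $ 1) = (*) u'"
    proof
      fix t
      have "M (t *\<^sub>R (1, 0)) = t *\<^sub>R M (1, 0)" by (rule M.scaleR)
      then show "- M (t, 0) $ 1 = u' * t" by (simp add: u'_def)
    qed
    ultimately show ?thesis
      unfolding has_field_derivative_def slope_sine_def[abs_def] by simp
  qed
  have near: "\<forall>\<^sub>F z in nhds ?z. r < norm z"
  proof -
    have "open {z::real\<times>real. r < norm z}" by (intro open_Collect_less continuous_intros)
    then show ?thesis using nz by (auto simp: eventually_nhds)
  qed
  have Dnorm: "(norm has_derivative (\<lambda>w. w \<bullet> sgn ?z)) (at ?z)"
    using x0 by (intro has_derivative_norm) (simp add: zero_prod_def)
  have Dun: "((\<lambda>z. ?u (norm z)) has_derivative (\<lambda>w. u' * fst w)) (at ?z)"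
  proof -
    have "(?u has_derivative (\<lambda>t. u' * t)) (at (norm ?z))"
      using Du x0 by (simp add: has_field_derivative_def)
    from has_derivative_compose[OF Dnorm this] show ?thesis
      using x0 by (simp add: sgn_div_norm case_prod_beta' inner_prod_def)
  qed
  have M1: "M w $ 1 = - u' * fst w" for w
  proof -
    have "((\<lambda>z. - ?u (norm z) * fst z / norm z) has_derivative (\<lambda>w. - u' * fst w)) (at ?z)"
      by (rule has_derivative_eq_rhs, rule has_derivative_divide, rule has_derivative_mult,
          rule has_derivative_minus[OF Dun], rule has_derivative_fst[OF has_derivative_ident], rule Dnorm)
         (use x0 in \<open>auto simp: inner_prod_def sgn_div_norm field_simps power2_eq_square\<close>)
    moreover have "\<forall>\<^sub>F z in nhds ?z. - ?u (norm z) * fst z / norm z = \<eta> (G z) $ 1"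
      using near by eventually_elim (metis normal_on_sheet(1) prod.collapse)
    ultimately have "((\<lambda>z. \<eta> (G z) $ 1) has_derivative (\<lambda>w. - u' * fst w)) (at ?z)"
      by (rule has_derivative_cong_nhds)
    then show ?thesis using DMi[of 1] has_derivative_unique by metis
  qed
  have M2: "M w $ 2 = - (?u x / x) * snd w" for w
  proof -
    have "((\<lambda>z. - ?u (norm z) * snd z / norm z) has_derivative (\<lambda>w. - (?u x / x) * snd w)) (at ?z)"
      by (rule has_derivative_eq_rhs, rule has_derivative_divide, rule has_derivative_mult,
          rule has_derivative_minus[OF Dun], rule has_derivative_snd[OF has_derivative_ident], rule Dnorm)
         (use x0 in \<open>auto simp: inner_prod_def sgn_div_norm field_simps power2_eq_square\<close>)
    moreover have "\<forall>\<^sub>F z in nhds ?z. - ?u (norm z) * snd z / norm z = \<eta> (G z) $ 2"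
      using near by eventually_elim (metis normal_on_sheet(2) prod.collapse)
    ultimately have "((\<lambda>z. \<eta> (G z) $ 2) has_derivative (\<lambda>w. - (?u x / x) * snd w)) (at ?z)"
      by (rule has_derivative_cong_nhds)
    then show ?thesis using DMi[of 2] has_derivative_unique by metis
  qed
  have eig: "u' * (dX X q w $ 1) = k * (dX X q w $ 1)" "?u x / x * (dX X q w $ 2) = k * (dX X q w $ 2)"
    if "- dX (\<eta> \<circ> X) q w = k *\<^sub>R dX X q w" for w k
  proof -
    have "M (proj_xy (dX X q w)) = - (k *\<^sub>R dX X q w)"
      using that \<Phi>(4)[rule_format, of w] by (simp add: M_def flip: that)
    then show "u' * (dX X q w $ 1) = k * (dX X q w $ 1)" "?u x / x * (dX X q w $ 2) = k * (dX X q w $ 2)"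
      using M1[of "proj_xy (dX X q w)"] M2[of "proj_xy (dX X q w)"] by (auto simp: proj_xy_def)
  qed
  define e1 e2 where "e1 = dX X q w1" and "e2 = dX X q w2"
  have "u' + ?u x / x = k1 + k2"
  proof (rule sum_of_eigenvalues_of_diagonal)
    show "e1 $ 1 * e2 $ 2 \<noteq> e2 $ 1 * e1 $ 2"
    proof
      assume det: "e1 $ 1 * e2 $ 2 = e2 $ 1 * e1 $ 2"
      have n: "\<eta> (G ?z) $ 1 * e $ 1 + \<eta> (G ?z) $ 3 * e $ 3 = 0" if "e = e1 \<or> e = e2" for e
        using \<Phi>(7)[rule_format, of w1] \<Phi>(7)[rule_format, of w2] that normal_on_sheet(2)[of x 0] nz 
        by (auto simp: e1_def e2_def inner_vec_def sum_3)
      define c where "c = \<eta> (G ?z) $ 1 / \<eta> (G ?z) $ 3"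
      have e3: "e $ 3 = - c * e $ 1" if "e = e1 \<or> e = e2" for e
      proof -
        have "\<eta> (G ?z) $ 3 \<noteq> 0" using side[OF nz] by auto
        moreover have "e $ 3 * \<eta> (G ?z) $ 3 = - (\<eta> (G ?z) $ 1 * e $ 1)"
          using n[OF that] by (simp add: algebra_simps eq_neg_iff_add_eq_0)
        ultimately show ?thesis by (simp add: c_def field_simps)
      qed
      \<comment> \<open>Both third components are the same multiple of the first ones, so dependent projections come from dependent vectors.\<close>
      have "e1 $ 1 *\<^sub>R e2 = e2 $ 1 *\<^sub>R e1" "e1 $ 2 *\<^sub>R e2 = e2 $ 2 *\<^sub>R e1"
        using det e3[of e1] e3[of e2] by (auto simp: vec_eq_iff forall_3 algebra_simps)
      then have "(e1 $ 1 *\<^sub>R e2) \<bullet> e2 = (e2 $ 1 *\<^sub>R e1) \<bullet> e2" "(e1 $ 2 *\<^sub>R e2) \<bullet> e2 = (e2 $ 2 *\<^sub>R e1) \<bullet> e2"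
        by simp_all
      then have "e1 $ 1 = 0" "e1 $ 2 = 0"
        using w(1-3) by (auto simp: e1_def e2_def norm_eq_1)
      then have "e1 = 0" using e3[of e1] by (simp add: vec_eq_iff forall_3)
      then show False using w by (simp add: e1_def)
    qed
  qed (use eig[OF w(4)] eig[OF w(5)] in \<open>auto simp: e1_def e2_def\<close>)
  moreover have "\<eta> (G ?z) $ 3 = \<sigma> * sqrt (1 - (?u x)\<^sup>2)"
    using normal_on_sheet(3)[of x 0] nz x0 by simp
  ultimately have "u' = 2 * H (\<sigma> * sqrt (1 - (?u x)\<^sup>2)) - ?u x / x" using Hk by simp
  then show ?thesis using Du by simp
qed

lemma end_profile_sheet: "end_profile (\<lambda>y. H (\<sigma> * y)) r slope_sine (\<lambda>x. \<sigma> * f x)"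
  unfolding end_profile_def
proof (intro conjI allI impI)
  show "0 < r" by (rule r_pos)
  show "slope_sine r = 1" using waist by (simp add: slope_sine_def)
  show "continuous_on {r..} (\<lambda>x. \<sigma> * f x)" using cont by (intro continuous_intros)
  have "\<forall>i. continuous_on {r..} (\<lambda>x. G (x, 0) $ i)"
    unfolding forall_3 graph_lift_nth using r_pos
    by (auto intro!: continuous_intros continuous_on_compose2[OF cont])
  then have contG: "continuous_on {r..} (\<lambda>x. G (x, 0))"
    unfolding continuous_on_def by (intro ballI vec_tendstoI) blast
  have "continuous_on S \<eta>"
    using H_surface unfolding H_surface_def unit_normal_def by blast
  then have "continuous_on {r..} (\<lambda>x. \<eta> (G (x, 0)))"
    by (rule continuous_on_compose2[OF _ contG]) (use r_pos in \<open>auto intro!: G_mem\<close>)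
  then show "continuous_on {r..} slope_sine"
    unfolding slope_sine_def[abs_def] by (intro continuous_intros)
  fix x assume x: "r < x"
  have n: "norm (x, 0::real) = x" "r < norm (x, 0::real)" using x r_pos by auto
  show "\<bar>slope_sine x\<bar> < 1" using normal_on_sheet(4)[of x 0] n by simp
  show "(slope_sine has_real_derivative 2 * H (\<sigma> * sqrt (1 - (slope_sine x)\<^sup>2)) - slope_sine x / x) (at x)"
    using profile_equation[OF x] .
  have "(f has_real_derivative \<sigma> * slope_sine x / sqrt (1 - (slope_sine x)\<^sup>2)) (at x)"
    using normal_on_sheet(5)[of x 0] n by simp
  from DERIV_cmult[OF this, of \<sigma>]
  show "((\<lambda>x. \<sigma> * f x) has_real_derivative slope_sine x / sqrt (1 - (slope_sine x)\<^sup>2)) (at x)"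
    using sign by auto
qed

end

section \<open>The ends of catenoids\<close>

lemma rotated_graph_section:
  assumes "0 < r" "r \<le> x"
  shows "(THE z. vector [x, 0, z] \<in> rotated_graph r f) = f x"
  using assms by (auto simp: rotated_graph_def axis_dist_def)

text \<open>
  A continuous derivative on a compact interval is bounded, so the function is Lipschitz.
\<close>

lemma C1_class_end_curvature:
  assumes "H \<in> C1_class" and \<sigma>: "\<sigma> = 1 \<or> \<sigma> = -1"
  shows "end_curvature (\<lambda>y. H (\<sigma> * y))"
proof -
  obtain H' where H': "\<And>y. y \<in> {-1..1} \<Longrightarrow> (H has_real_derivative H' y) (at y within {-1..1})"
      "continuous_on {-1..1} H'"
    and neg: "\<And>y. y \<in> {-1<..<1} \<Longrightarrow> H y < 0" and "H (-1) = 0" "H 1 = 0"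
    using assms(1) unfolding C1_class_def by blast
  have "bounded (H' ` {-1..1})"
    using compact_continuous_image[OF H'(2)] compact_imp_bounded by blast
  then obtain L where "\<forall>z\<in>H' ` {-1..1}. norm z \<le> L" unfolding bounded_iff by blast
  then have L: "norm (H' y) \<le> L" if "y \<in> {-1..1}" for y using that by blast
  have "0 \<le> L" using L[of 0] by (smt (verit) atLeastAtMost_iff norm_ge_zero)
  have Lip: "\<bar>H y - H z\<bar> \<le> L * \<bar>y - z\<bar>" if "y \<in> {-1..1}" "z \<in> {-1..1}" for y z
    using field_differentiable_bound[OF _ H'(1) L, of y z] that by simp
  show ?thesis
    unfolding end_curvature_def
  proof (intro conjI ballI exI[of _ L])
    fix y :: real assume "y \<in> {0..1}"
    then show "\<bar>H (\<sigma> * y)\<bar> \<le> L * (1 - y)"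
      using Lip[of "\<sigma> * y" \<sigma>] \<sigma> \<open>H 1 = 0\<close> \<open>H (-1) = 0\<close> by (auto simp: abs_real_def split: if_splits)
  qed (use \<sigma> neg \<open>0 \<le> L\<close> \<open>H 1 = 0\<close> \<open>H (-1) = 0\<close> in auto)
qed

lemma ratio_limit_imp_comparable:
  fixes P Q :: "real \<Rightarrow> real"
  assumes P: "\<forall>\<^sub>F y in A. P y < 0" and Q: "\<forall>\<^sub>F y in A. Q y < 0"
    and lim: "((\<lambda>y. P y / Q y) \<longlongrightarrow> C) A" and C: "C \<noteq> 0" and A: "A \<noteq> bot"
  shows "\<exists>a>0. \<forall>\<^sub>F y in A. P y \<le> a * Q y" "\<exists>a>0. \<forall>\<^sub>F y in A. Q y \<le> a * P y"
proof -
  have "\<forall>\<^sub>F y in A. 0 \<le> P y / Q y"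
    using P Q by eventually_elim (simp add: divide_nonpos_nonpos)
  then have "0 \<le> C" using lim A by (intro tendsto_lowerbound)
  with C have C: "0 < C" by simp
  then have lo: "\<forall>\<^sub>F y in A. C / 2 < P y / Q y" and hi: "\<forall>\<^sub>F y in A. P y / Q y < 2 * C"
    by (intro order_tendstoD[OF lim]; simp)+
  have "\<forall>\<^sub>F y in A. P y \<le> (C / 2) * Q y"
    using lo Q by eventually_elim (simp add: field_simps)
  moreover have "\<forall>\<^sub>F y in A. Q y \<le> (1 / (2 * C)) * P y"
    using hi Q by eventually_elim (use C in \<open>simp add: field_simps\<close>)
  ultimately show "\<exists>a>0. \<forall>\<^sub>F y in A. P y \<le> a * Q y" "\<exists>a>0. \<forall>\<^sub>F y in A. Q y \<le> a * P y"
    using C by (meson half_gt_zero zero_less_divide_1_iff mult_pos_pos zero_less_numeral)+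
qed

lemma catenoid_end_profiles:
  assumes "catenoid H r S" "0 < r"
  shows "\<exists>u f. end_profile H r u f \<and> (\<forall>x\<ge>r. upper_height S x = f x)"
    and "\<exists>u f. end_profile (\<lambda>y. H (- y)) r u f \<and> (\<forall>x\<ge>r. lower_height S x = - f x)"
proof -
  obtain \<eta> f g where \<eta>: "H_surface H S \<eta>"
    and waist: "{p\<in>S. p$3 = 0} = {p. p$3 = 0 \<and> axis_dist p = r}"
    and waist_normal: "\<And>p. p \<in> S \<Longrightarrow> p$3 = 0 \<Longrightarrow> \<eta> p = - (1 / r) *\<^sub>R p"
    and up: "\<And>p. p \<in> S \<Longrightarrow> p$3 > 0 \<Longrightarrow> \<eta> p \<bullet> axis 3 1 > 0"
    and down: "\<And>p. p \<in> S \<Longrightarrow> p$3 < 0 \<Longrightarrow> \<eta> p \<bullet> axis 3 1 < 0"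
    and f: "continuous_on {r..} f" "upper_end S = rotated_graph r f"
    and g: "continuous_on {r..} g" "lower_end S = rotated_graph r g"
    using assms(1) unfolding catenoid_def bigraph_def by blast
  define p where "p = (vector [r, 0, 0] :: real^3)"
  have p: "p \<in> S" "p $ 3 = 0" "axis_dist p = r" "p $ 1 = r"
  proof -
    show *: "p $ 3 = 0" "axis_dist p = r" "p $ 1 = r" using assms(2) by (auto simp: p_def axis_dist_def)
    show "p \<in> S" using waist * by blast
  qed
  have sheet: "rotational_sheet H S \<eta> r \<sigma> h"
    if \<sigma>: "\<sigma> = 1 \<or> \<sigma> = -1" and h: "continuous_on {r..} h" "rotated_graph r h = {p\<in>S. 0 \<le> \<sigma> * p$3}" for \<sigma> h
  proof
    show "\<sigma> = 1 \<or> \<sigma> = -1" by fact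
    show "rotated_graph r h \<subseteq> S" using h by blast
    have "p \<in> rotated_graph r h" using p h by simp
    then have "h r = 0" using p by (simp add: rotated_graph_def)
    then have "graph_lift h (r, 0) = p" using assms(2) by (simp add: p_def graph_lift_def)
    then show "\<eta> (graph_lift h (r, 0)) $ 1 = -1" using waist_normal[of p] p assms(2) by simp
    fix z :: "real \<times> real" assume z: "r < norm z"
    let ?p = "graph_lift h z"
    have "?p \<in> rotated_graph r h" using z by (simp add: graph_lift_in_rotated_graph)
    then have P: "?p \<in> S" "0 \<le> \<sigma> * ?p $ 3" unfolding h by auto
    have "?p $ 3 \<noteq> 0"
    proof
      assume "?p $ 3 = 0"
      then have "?p \<in> {p. p$3 = 0 \<and> axis_dist p = r}" using P(1) waist by blast
      then show False using z by simp
    qed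
    then have "0 < \<sigma> * ?p $ 3" using P(2) \<sigma> by (auto simp: less_le)
    then show "0 < \<sigma> * \<eta> ?p $ 3"
      using up[OF P(1)] down[OF P(1)] \<sigma> by (auto simp: inner_axis)
  qed (use \<eta> assms(2) h in auto)
  interpret U: rotational_sheet H S \<eta> r 1 f
    using sheet[of 1 f] f by (simp add: upper_end_def)
  interpret D: rotational_sheet H S \<eta> r "-1" g
    using sheet[of "-1" g] g by (simp add: lower_end_def)
  have "\<forall>x\<ge>r. upper_height S x = f x" "\<forall>x\<ge>r. lower_height S x = g x"
    unfolding upper_height_def lower_height_def f(2) g(2) using rotated_graph_section assms(2) by auto
  then show "\<exists>u f. end_profile H r u f \<and> (\<forall>x\<ge>r. upper_height S x = f x)"
    "\<exists>u f. end_profile (\<lambda>y. H (- y)) r u f \<and> (\<forall>x\<ge>r. lower_height S x = - f x)"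
    using U.end_profile_sheet D.end_profile_sheet by fastforce+
qed

lemma bounded_height_equivalence:
  assumes "end_profile P r u f" "end_curvature P" "end_profile Q s v g" "end_curvature Q"
    and "C \<noteq> 0" "((\<lambda>y. P y / Q y) \<longlongrightarrow> C) (at_left 1)"
  shows "bounded (f ` {r<..}) \<longleftrightarrow> bounded (g ` {s<..})"
proof -
  have ev: "\<forall>\<^sub>F y in at_left (1::real). y \<in> {0<..<1}"
    by (rule eventually_at_leftI[of 0]) auto
  have "\<forall>\<^sub>F y in at_left 1. P y < 0" "\<forall>\<^sub>F y in at_left 1. Q y < 0"
    using ev assms(2,4) unfolding end_curvature_def by (auto elim!: eventually_mono)
  from ratio_limit_imp_comparable[OF this assms(6,5) trivial_limit_at_left_real]
  obtain a b where "0 < a" "\<forall>\<^sub>F y in at_left 1. P y \<le> a * Q y"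
      "0 < b" "\<forall>\<^sub>F y in at_left 1. Q y \<le> b * P y"
    by blast
  then show ?thesis
    using bounded_height_comparison[OF assms(1-4)] bounded_height_comparison[OF assms(3,4,1,2)] by blast
qed

lemma sim_1_same_upper_behavior:
  assumes "H \<in> C1_class" "F \<in> C1_class" "sim_1 H F"
    and "0 < r" "catenoid H r S" "0 < s" "catenoid F s T"
  shows "same_upper_behavior s T r S"
proof -
  obtain u f where f: "end_profile H r u f" "\<forall>x\<ge>r. upper_height S x = f x"
    using catenoid_end_profiles(1) assms by blast
  obtain v g where g: "end_profile F s v g" "\<forall>x\<ge>s. upper_height T x = g x"
    using catenoid_end_profiles(1) assms by blast
  have "bounded (f ` {r<..}) \<longleftrightarrow> bounded (g ` {s<..})"
    using bounded_height_equivalence[OF f(1) _ g(1)] C1_class_end_curvature[of _ 1] assms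
    by (auto simp: sim_1_def)
  moreover have "upper_height S ` {r<..} = f ` {r<..}" "upper_height T ` {s<..} = g ` {s<..}"
    using f(2) g(2) by (auto intro!: image_cong)
  ultimately show ?thesis by (simp add: same_upper_behavior_def)
qed

lemma sim_minus_1_same_lower_behavior:
  assumes "H \<in> C1_class" "F \<in> C1_class" "sim_minus_1 H F"
    and "0 < r" "catenoid H r S" "0 < s" "catenoid F s T"
  shows "same_lower_behavior s T r S"
proof -
  obtain u f where f: "end_profile (\<lambda>y. H (- y)) r u f" "\<forall>x\<ge>r. lower_height S x = - f x"
    using catenoid_end_profiles(2) assms by blast
  obtain v g where g: "end_profile (\<lambda>y. F (- y)) s v g" "\<forall>x\<ge>s. lower_height T x = - g x"
    using catenoid_end_profiles(2) assms by blast
  obtain C where "C \<noteq> 0" "((\<lambda>y. H y / F y) \<longlongrightarrow> C) (at_right (-1))"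
    using assms unfolding sim_minus_1_def by blast
  then have C: "C \<noteq> 0" "((\<lambda>y. H (- y) / F (- y)) \<longlongrightarrow> C) (at_left 1)"
    by (simp_all add: at_right_minus filterlim_filtermap)
  then have "bounded (f ` {r<..}) \<longleftrightarrow> bounded (g ` {s<..})"
    using bounded_height_equivalence[OF f(1) _ g(1) _ C]
      C1_class_end_curvature[of H "-1"] C1_class_end_curvature[of F "-1"] assms(1,2)
    by simp
  moreover have "lower_height S ` {r<..} = uminus ` f ` {r<..}" "lower_height T ` {s<..} = uminus ` g ` {s<..}"
    unfolding image_image using f(2) g(2) by (auto intro!: image_cong)
  ultimately show ?thesis by (simp add: same_lower_behavior_def bounded_uminus)
qed

theorem theorem3p5:
  fixes H F :: "real \<Rightarrow> real" and r\<^sub>0 :: real and S :: "(real^3) set"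
  assumes "H \<in> C1_class" and "F \<in> C1_class" and "r\<^sub>0 > 0" and "catenoid H r\<^sub>0 S"
  shows "(sim_1 H F \<longrightarrow>
            (\<forall>r>0. \<forall>T. catenoid F r T \<longrightarrow> same_upper_behavior r T r\<^sub>0 S)) \<and>
         (sim_minus_1 H F \<longrightarrow>
            (\<forall>r>0. \<forall>T. catenoid F r T \<longrightarrow> same_lower_behavior r T r\<^sub>0 S)) \<and>
         (sim H F \<longrightarrow>
            (\<forall>r>0. \<forall>T. catenoid F r T \<longrightarrow>
               same_upper_behavior r T r\<^sub>0 S \<and> same_lower_behavior r T r\<^sub>0 S))"
  unfolding sim_def
  using sim_1_same_upper_behavior[OF assms(1,2) _ assms(3,4)]
    sim_minus_1_same_lower_behavior[OF assms(1,2) _ assms(3,4)]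
  by blast

end
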